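(* For every integer $i\ge 1$ there is a bijection between the set of rooted compositions of Dyck paths of length $2i$ (with any number of segments) and the set of sequences of length $i-1$ on the four letters $\{1,2,3,4\}$.
   Context: A Dyck path of length $2n$ is a lattice path from $(0,0)$ to $(2n,0)$ with up steps $U=(1,1)$ and down steps $D=(1,-1)$ that never goes below the $x$-axis. A composition of a Dyck path $P$ is a sequence $(P_1,\dots,P_j)$ ($j\ge 1$) of nonempty Dyck paths such that $P=P_1P_2\cdots P_j$ (concatenation); $j$ is called the number of segments, and the length of the composition is the length of $P$. A rooted composition is a composition $(P_1,\dots,P_j)$ together with a choice of one distinguished segment $P_t$, $1\le t\le j$. The set of rooted compositions of Dyck paths of length $2i$ ranges over all Dyck paths $P$ of length $2i$, all their compositions, and all choices of distinguished segment. *)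

theory Defs
  imports Main
begin

datatype step = U | D

fun step_vec :: "step \<Rightarrow> int \<times> int" where
  "step_vec U = (1, 1)"
| "step_vec D = (1, - 1)"

text \<open>A lattice path starting at the origin is given by its list of steps.\<close>

definition endpoint :: "step list \<Rightarrow> int \<times> int" where
  "endpoint P = ((\<Sum>s\<leftarrow>P. fst (step_vec s)), (\<Sum>s\<leftarrow>P. snd (step_vec s)))"

text \<open>The lattice points visited by \<open>P\<close> are the endpoints of its prefixes.\<close>

definition dyck_path :: "nat \<Rightarrow> step list \<Rightarrow> bool" where
  "dyck_path n P \<longleftrightarrow>
     endpoint P = (2 * int n, 0) \<and> (\<forall>k\<le>length P. 0 \<le> snd (endpoint (take k P)))"

definition dyck_composition :: "step list \<Rightarrow> step list list \<Rightarrow> bool" where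
  "dyck_composition P Ps \<longleftrightarrow>
     1 \<le> length Ps \<and> (\<forall>Q\<in>set Ps. Q \<noteq> [] \<and> (\<exists>m. dyck_path m Q)) \<and> concat Ps = P"

text \<open>In a rooted composition \<open>(Ps, t)\<close> the distinguished segment is recorded by its
  position \<open>t\<close>, counted from 1, since equal segments may occur at several positions.\<close>

definition rooted_compositions :: "nat \<Rightarrow> (step list list \<times> nat) set" where
  "rooted_compositions i =
     {(Ps, t). (\<exists>P. dyck_path i P \<and> dyck_composition P Ps) \<and> 1 \<le> t \<and> t \<le> length Ps}"

definition four_letter_seqs :: "nat \<Rightarrow> nat list set" where
  "four_letter_seqs m = {w. length w = m \<and> set w \<subseteq> {1, 2, 3, 4}}"

end

theory Submission
  imports Defs "HOL-Computational_Algebra.Formal_Power_Series"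
begin

unbundle fps_syntax

text \<open>The two sets are finite and have the same cardinality, which is computed with generating
  functions. Let \<open>C\<close>, \<open>B\<close>, \<open>W\<close> count Dyck paths, compositions (the empty one included) and rooted
  compositions by semilength, measured as the number of up steps so that it is visibly additive
  under concatenation. Cutting a Dyck path at its first return gives \<open>C = 1 + X C\<^sup>2\<close>,
  splitting off the first segment gives \<open>B = 1 + (C - 1) B\<close>, and cutting around the distinguished
  segment gives \<open>W = B (C - 1) B\<close>. As \<open>(2 - C)\<^sup>2 = C\<^sup>2 - 4 (C - 1) = C\<^sup>2 (1 - 4 X)\<close>, it follows that
  \<open>W C\<^sup>2 (1 - 4 X) = W (2 - C)\<^sup>2 = C - 1 = X C\<^sup>2\<close>, that is, \<open>W (1 - 4 X) = X\<close>.\<close>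

section \<open>Counting generating functions\<close>

text \<open>Since \<open>card\<close> is 0 on infinite sets, coefficients of \<open>gf\<close> are
  honest counts only under this condition; the sum and product rules rely on it.\<close>

definition finite_fibres :: "('a \<Rightarrow> nat) \<Rightarrow> 'a set \<Rightarrow> bool" where
  "finite_fibres w S \<longleftrightarrow> (\<forall>n. finite {x \<in> S. w x = n})"

text \<open>Integer coefficients allow subtraction and make the power series an integral domain, so
  that a nonzero factor can be cancelled at the end.\<close>

definition gf :: "('a \<Rightarrow> nat) \<Rightarrow> 'a set \<Rightarrow> int fps" where
  "gf w S = Abs_fps (\<lambda>n. int (card {x \<in> S. w x = n}))"

lemma gf_nth: "gf w S $ n = int (card {x \<in> S. w x = n})"
  by (simp add: gf_def)

lemma finite_fibres_subset: "finite_fibres w T \<Longrightarrow> S \<subseteq> T \<Longrightarrow> finite_fibres w S"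
  unfolding finite_fibres_def by (auto intro: rev_finite_subset)

lemma gf_singleton: "gf w {a} = fps_X ^ w a"
proof (rule fps_ext)
  fix n
  have "{x \<in> {a}. w x = n} = (if w a = n then {a} else {})" by auto
  then show "gf w {a} $ n = fps_X ^ w a $ n" by (simp add: gf_nth)
qed

lemma gf_Un:
  assumes "finite_fibres w S" "finite_fibres w T" "S \<inter> T = {}"
  shows "gf w (S \<union> T) = gf w S + gf w T"
proof (rule fps_ext)
  fix n
  have "{x \<in> S \<union> T. w x = n} = {x \<in> S. w x = n} \<union> {x \<in> T. w x = n}" by auto
  moreover have "card ({x \<in> S. w x = n} \<union> {x \<in> T. w x = n}) =
      card {x \<in> S. w x = n} + card {x \<in> T. w x = n}"
    using assms by (intro card_Un_disjoint) (auto simp: finite_fibres_def)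
  ultimately show "gf w (S \<union> T) $ n = (gf w S + gf w T) $ n" by (simp add: gf_nth)
qed

lemma gf_bij_betw:
  assumes "bij_betw f S T" "\<And>x. x \<in> S \<Longrightarrow> v (f x) = w x"
  shows "gf v T = gf w S"
proof (rule fps_ext)
  fix n
  have "bij_betw f {x \<in> S. w x = n} {y \<in> T. v y = n}"
    using assms by (auto simp: bij_betw_def inj_on_def)
  then show "gf v T $ n = gf w S $ n" by (simp add: gf_nth bij_betw_same_card)
qed

lemma gf_Suc: "gf (\<lambda>x. Suc (w x)) S = fps_X * gf w S"
proof (rule fps_ext)
  fix n
  show "gf (\<lambda>x. Suc (w x)) S $ n = (fps_X * gf w S) $ n"
    by (cases n) (simp_all add: gf_nth)
qed

text \<open>Sorting pairs by the weight \<open>k\<close> of the first component mirrors the Cauchy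
  product of coefficients.\<close>

lemma pair_fibre:
  "{p \<in> S \<times> T. (case p of (x, y) \<Rightarrow> v x + w y) = (n :: nat)} =
     (\<Union>k\<in>{0..n}. {x \<in> S. v x = k} \<times> {y \<in> T. w y = n - k})"
  by auto

lemma finite_fibres_Times:
  assumes "finite_fibres v S" "finite_fibres w T"
  shows "finite_fibres (\<lambda>(x, y). v x + w y) (S \<times> T)"
  using assms unfolding finite_fibres_def by (simp add: pair_fibre)

lemma gf_Times:
  assumes "finite_fibres v S" "finite_fibres w T"
  shows "gf (\<lambda>(x, y). v x + w y) (S \<times> T) = gf v S * gf w T"
proof (rule fps_ext)
  fix n
  have "card {p \<in> S \<times> T. (case p of (x, y) \<Rightarrow> v x + w y) = n} =
      (\<Sum>k=0..n. card ({x \<in> S. v x = k} \<times> {y \<in> T. w y = n - k}))"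
    unfolding pair_fibre
    by (rule card_UN_disjoint) (use assms in \<open>auto simp: finite_fibres_def\<close>)
  then show "gf (\<lambda>(x, y). v x + w y) (S \<times> T) $ n = (gf v S * gf w T) $ n"
    by (simp add: gf_nth fps_mult_nth card_cartesian_product)
qed

section \<open>Dyck paths\<close>

definition height :: "step list \<Rightarrow> int" where
  "height P = (\<Sum>s\<leftarrow>P. snd (step_vec s))"

abbreviation ups :: "step list \<Rightarrow> nat" where
  "ups P \<equiv> count_list P U"

text \<open>Prefixes are given by splittings \<open>A @ B\<close> rather than by their lengths,
  which suits arguments that concatenate and cut paths.\<close>

definition dyck :: "step list set" where
  "dyck = {P. height P = 0 \<and> (\<forall>A B. P = A @ B \<longrightarrow> 0 \<le> height A)}"

lemma height_simps [simp]:
  "height [] = 0" "height (s # P) = snd (step_vec s) + height P" "height (P @ Q) = height P + height Q"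
  by (simp_all add: height_def)

lemma height_ups: "height P = 2 * int (ups P) - int (length P)"
proof (induction P)
  case (Cons s P)
  then show ?case by (cases s) auto
qed simp

lemma sum_fst_step_vec: "(\<Sum>s\<leftarrow>P. fst (step_vec s)) = int (length P)"
proof (induction P)
  case (Cons s P)
  then show ?case by (cases s) auto
qed simp

lemma dyck_length: "P \<in> dyck \<Longrightarrow> length P = 2 * ups P"
  using height_ups[of P] by (simp add: dyck_def)

text \<open>The first coordinate of the endpoint is the length, and at height 0 the length is twice
  the number of up steps.\<close>

lemma dyck_path_iff: "dyck_path n P \<longleftrightarrow> P \<in> dyck \<and> ups P = n"
proof -
  have "(\<forall>k\<le>length P. 0 \<le> height (take k P)) \<longleftrightarrow> (\<forall>A B. P = A @ B \<longrightarrow> 0 \<le> height A)"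
    by (metis append_eq_conv_conj append_take_drop_id le_add1 length_append)
  then show ?thesis
    using height_ups[of P]
    by (auto simp: dyck_path_def endpoint_def sum_fst_step_vec dyck_def height_def[symmetric])
qed

lemma Nil_dyck [simp]: "[] \<in> dyck"
  by (simp add: dyck_def)

lemma dyck_prefix: "A @ B \<in> dyck \<Longrightarrow> 0 \<le> height A"
  by (simp add: dyck_def)

lemma dyck_append:
  assumes "P \<in> dyck" "Q \<in> dyck"
  shows "P @ Q \<in> dyck"
  using assms by (fastforce simp: dyck_def append_eq_append_conv2)

lemma dyck_concat: "set Ps \<subseteq> dyck \<Longrightarrow> concat Ps \<in> dyck"
  by (induction Ps) (auto intro: dyck_append)

lemma dyck_elevate:
  assumes "P \<in> dyck"
  shows "U # P @ [D] \<in> dyck"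
proof -
  have "0 \<le> height A" if eq: "U # P @ [D] = A @ B" for A B
  proof (cases A)
    case (Cons a A')
    with eq have "a = U" "P @ [D] = A' @ B" by auto
    \<comment> \<open>A nonempty prefix is the whole path, of height 0, or \<open>U\<close> followed
      by a prefix of \<open>P\<close>, of height at least 1.\<close>
    from this(2) consider "B = []" "A' = P @ [D]" | B' where "P = A' @ B'"
      by (cases B rule: rev_cases) auto
    then show ?thesis
      using assms Cons \<open>a = U\<close> by cases (auto simp: dyck_def)
  qed simp
  with assms show ?thesis by (auto simp: dyck_def)
qed

text \<open>After the initial \<open>U\<close>, the rest \<open>R'\<close> first drops below its own
  starting level exactly when \<open>R\<close> first returns to the axis; the cut is made at that
  step.\<close>

lemma dyck_first_return:
  assumes "R \<in> dyck" "R \<noteq> []"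
  obtains P Q where "P \<in> dyck" "Q \<in> dyck" "R = U # P @ D # Q"
proof -
  from assms obtain s R' where R: "R = s # R'" by (cases R) auto
  have "s = U" using dyck_prefix[of "[s]" R'] assms R by (cases s) auto
  define k where "k = (LEAST k. height (take k R') < 0)"
  \<comment> \<open>The height of \<open>R'\<close> is -1, so some prefix is negative and the
    minimum \<open>k\<close> is attained.\<close>
  have "height R' < 0" using assms R \<open>s = U\<close> by (simp add: dyck_def)
  then have neg: "height (take k R') < 0"
    unfolding k_def by (metis LeastI order_refl take_all)
  have min: "0 \<le> height (take j R')" if "j < k" for j
    using not_less_Least that unfolding k_def by force
  obtain j where j: "k = Suc j" using neg by (cases k) auto
  \<comment> \<open>Otherwise \<open>take j R'\<close> and \<open>take k R'\<close> would both be
    \<open>R'\<close>, with contradictory signs.\<close>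
  have "j < length R'" using neg min[of j] j by (metis lessI linorder_not_less take_all le_SucI)
  then have tk: "take k R' = take j R' @ [R' ! j]" and dec: "R' = take j R' @ R' ! j # drop k R'"
    by (simp_all add: j take_Suc_conv_app_nth id_take_nth_drop[symmetric])
  define P Q where "P = take j R'" and "Q = drop k R'"
  \<comment> \<open>A step changes the height by one, so passing from nonnegative to negative forces
    a \<open>D\<close> taken at height 0.\<close>
  have h: "0 \<le> height P" "height P + snd (step_vec (R' ! j)) < 0"
    using min[of j] neg tk j by (auto simp: P_def)
  then have D: "R' ! j = D" and hP: "height P = 0" by (cases "R' ! j"; simp)+
  have eq: "R = U # P @ D # Q" using dec D R \<open>s = U\<close> by (simp add: P_def Q_def)
  have "P \<in> dyck"
  proof -
    have "0 \<le> height A" if "P = A @ B" for A B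
    proof -
      \<comment> \<open>A prefix of \<open>P\<close> is a prefix of \<open>R'\<close> shorter than
        \<open>k\<close>, hence covered by minimality.\<close>
      have "R' = A @ B @ R' ! j # drop k R'" using dec that unfolding P_def by (metis append_assoc)
      then have "A = take (length A) R'" by (metis append_eq_conv_conj)
      moreover have "length A \<le> length P" "length P \<le> j" using that by simp (simp add: P_def)
      then have "length A < k" using j by simp
      ultimately show ?thesis using min by metis
    qed
    with hP show ?thesis by (auto simp: dyck_def)
  qed
  moreover have "Q \<in> dyck"
  proof -
    have "0 \<le> height A" if "Q = A @ B" for A B
      using dyck_prefix[of "U # P @ D # A" B] assms(1) eq that hP by simp
    with assms(1) eq hP show ?thesis by (auto simp: dyck_def)
  qed
  ultimately show thesis using that eq by blast
qed

lemma first_return_unique: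
  assumes "P \<in> dyck" "P' \<in> dyck" "P @ D # Q = P' @ D # Q'"
  shows "P = P' \<and> Q = Q'"
proof -
  \<comment> \<open>If the two cuts differed, the longer first part would start with the shorter one
    followed by \<open>D\<close>, which has height -1.\<close>
  have no_return: False if "P \<in> dyck" "P @ D # R \<in> dyck" for P R
    using dyck_prefix[of "P @ [D]" R] that by (simp add: dyck_def)
  from assms(3) obtain S where "P = P' @ S \<and> S @ D # Q = D # Q' \<or> P @ S = P' \<and> D # Q = S @ D # Q'"
    unfolding append_eq_append_conv2 by blast
  then show ?thesis
    using assms no_return by (cases S) auto
qed

lemma bij_betw_first_return: "bij_betw (\<lambda>(P, Q). U # P @ D # Q) (dyck \<times> dyck) (dyck - {[]})"
proof (rule bij_betw_imageI)
  show "inj_on (\<lambda>(P, Q). U # P @ D # Q) (dyck \<times> dyck)"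
    by (rule inj_onI) (auto dest: first_return_unique)
  have "U # P @ D # Q \<in> dyck" if "P \<in> dyck" "Q \<in> dyck" for P Q
    using dyck_append[OF dyck_elevate[OF that(1)] that(2)] by simp
  moreover have "R \<in> (\<lambda>(P, Q). U # P @ D # Q) ` (dyck \<times> dyck)" if "R \<in> dyck" "R \<noteq> []" for R
    using that by (rule dyck_first_return) force
  ultimately show "(\<lambda>(P, Q). U # P @ D # Q) ` (dyck \<times> dyck) = dyck - {[]}"
    by auto
qed

section \<open>Finiteness and the generating function of Dyck paths\<close>

lemma finite_step_lists: "finite {P :: step list. length P \<le> n}"
proof -
  have "(UNIV :: step set) = {U, D}" using step.exhaust by auto
  then have "finite (UNIV :: step set)" by (metis finite.emptyI finite.insertI)
  then show ?thesis using finite_lists_length_le[of UNIV n] by simp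
qed

lemma finite_fibres_dyck: "finite_fibres ups dyck"
  unfolding finite_fibres_def
proof
  fix n
  show "finite {P \<in> dyck. ups P = n}"
    by (rule finite_subset[OF _ finite_step_lists[of "2 * n"]]) (auto simp: dyck_length)
qed

lemma gf_nonempty_dyck: "gf ups (dyck - {[]}) = fps_X * (gf ups dyck)\<^sup>2"
proof -
  \<comment> \<open>The \<open>Suc\<close> counts the initial \<open>U\<close> and yields the factor
    \<open>fps_X\<close>.\<close>
  have "gf ups (dyck - {[]}) = gf (\<lambda>p. Suc (case p of (P, Q) \<Rightarrow> ups P + ups Q)) (dyck \<times> dyck)"
    by (rule gf_bij_betw[OF bij_betw_first_return]) auto
  then show ?thesis
    by (simp only: gf_Suc gf_Times[OF finite_fibres_dyck finite_fibres_dyck] power2_eq_square)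
qed

lemma gf_dyck: "gf ups dyck = 1 + gf ups (dyck - {[]})"
proof -
  have "finite_fibres ups {[]}" "finite_fibres ups (dyck - {[]})"
    by (rule finite_fibres_subset[OF finite_fibres_dyck]; simp)+
  from gf_Un[OF this] have "gf ups ({[]} \<union> (dyck - {[]})) = gf ups {[]} + gf ups (dyck - {[]})" by simp
  moreover have "{[]} \<union> (dyck - {[]}) = dyck" by auto
  ultimately show ?thesis by (simp add: gf_singleton)
qed

section \<open>Compositions\<close>

abbreviation segments :: "step list set" where
  "segments \<equiv> dyck - {[]}"

abbreviation total_ups :: "step list list \<Rightarrow> nat" where
  "total_ups Ps \<equiv> ups (concat Ps)"

lemma segment_ups: "P \<in> segments \<Longrightarrow> 1 \<le> ups P"
  using dyck_length[of P] by (cases "ups P") auto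

text \<open>Each segment contributes an up step. Bounding the number of segments this way is half of
  the finiteness of compositions of given weight.\<close>

lemma length_le_total_ups: "Ps \<in> lists segments \<Longrightarrow> length Ps \<le> total_ups Ps"
proof (induction Ps)
  case (Cons P Ps)
  then show ?case using segment_ups[of P] by auto
qed simp

lemma length_le_concat: "Q \<in> set Ps \<Longrightarrow> length Q \<le> length (concat Ps)"
  by (induction Ps) auto

lemma finite_fibres_compositions: "finite_fibres total_ups (lists segments)"
  unfolding finite_fibres_def
proof
  fix n
  \<comment> \<open>The other half: no segment is longer than the whole path.\<close>
  have "length Q \<le> 2 * n" if "Ps \<in> lists segments" "total_ups Ps = n" "Q \<in> set Ps" for Ps Q
  proof -
    have "concat Ps \<in> dyck" using that by (intro dyck_concat) auto
    then show ?thesis using length_le_concat[OF that(3)] dyck_length that(2) by auto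
  qed
  then have "{Ps \<in> lists segments. total_ups Ps = n} \<subseteq>
      {Ps. set Ps \<subseteq> {Q. length Q \<le> 2 * n} \<and> length Ps \<le> n}"
    using length_le_total_ups by auto
  then show "finite {Ps \<in> lists segments. total_ups Ps = n}"
    by (rule finite_subset) (intro finite_lists_length_le finite_step_lists)
qed

lemma gf_compositions:
  "gf total_ups (lists segments) = 1 + gf ups segments * gf total_ups (lists segments)"
proof -
  let ?Cons = "\<lambda>(P, Ps). P # Ps"
  have bij: "bij_betw ?Cons (segments \<times> lists segments) (lists segments - {[]})"
  proof (rule bij_betw_imageI)
    show "inj_on ?Cons (segments \<times> lists segments)" by (auto simp: inj_on_def)
    have "Ps \<in> ?Cons ` (segments \<times> lists segments)" if "Ps \<in> lists segments - {[]}" for Ps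
    proof -
      from that obtain Q Qs where "Ps = ?Cons (Q, Qs)" "(Q, Qs) \<in> segments \<times> lists segments"
        by (cases Ps) auto
      then show ?thesis by (rule image_eqI)
    qed
    then show "?Cons ` (segments \<times> lists segments) = lists segments - {[]}" by auto
  qed
  have "gf total_ups (lists segments - {[]}) =
      gf (\<lambda>(P, Ps). ups P + total_ups Ps) (segments \<times> lists segments)"
    by (rule gf_bij_betw[OF bij]) auto
  also have "\<dots> = gf ups segments * gf total_ups (lists segments)"
    using finite_fibres_subset[OF finite_fibres_dyck, of segments] finite_fibres_compositions
    by (intro gf_Times) auto
  finally have *: "gf total_ups (lists segments - {[]}) = \<dots>" .
  have "finite_fibres total_ups {[]}" "finite_fibres total_ups (lists segments - {[]})"
    by (rule finite_fibres_subset[OF finite_fibres_compositions]; auto)+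
  from gf_Un[OF this] have "gf total_ups ({[]} \<union> (lists segments - {[]})) =
      gf total_ups {[]} + gf total_ups (lists segments - {[]})" by simp
  moreover have "{[]} \<union> (lists segments - {[]}) = lists segments" by auto
  ultimately show ?thesis by (simp add: gf_singleton *)
qed

section \<open>Rooted compositions\<close>

definition rooted :: "(step list list \<times> nat) set" where
  "rooted = {(Ps, t). Ps \<in> lists segments \<and> 1 \<le> t \<and> t \<le> length Ps}"

text \<open>The underlying path can only be \<open>concat Ps\<close>, which is automatically Dyck,
  so the condition on it reduces to its number of up steps.\<close>

lemma rooted_compositions_eq: "rooted_compositions i = {p \<in> rooted. total_ups (fst p) = i}"
  by (auto simp: rooted_compositions_def rooted_def dyck_composition_def dyck_path_iff
      intro!: dyck_concat)

abbreviation mark :: "step list list \<times> step list \<times> step list list \<Rightarrow> step list list \<times> nat" where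
  "mark \<equiv> \<lambda>(A, P, B). (A @ P # B, Suc (length A))"

lemma bij_betw_mark: "bij_betw mark (lists segments \<times> segments \<times> lists segments) rooted"
proof (rule bij_betw_imageI)
  \<comment> \<open>Equal positions force the parts \<open>A\<close> to have equal length, so both
    lists are cut at the same place.\<close>
  show "inj_on mark (lists segments \<times> segments \<times> lists segments)"
    by (auto simp: inj_on_def)
  have "p \<in> mark ` (lists segments \<times> segments \<times> lists segments)" if "p \<in> rooted" for p
  proof -
    \<comment> \<open>Positions count from 1 and list indices from 0, so position
      \<open>Suc j\<close> is the entry \<open>Ps ! j\<close>.\<close>
    from that obtain Ps j where p: "p = (Ps, Suc j)" and Ps: "Ps \<in> lists segments" and j: "j < length Ps"
      by (cases p; cases "snd p") (auto simp: rooted_def)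
    have eq: "Ps = take j Ps @ Ps ! j # drop (Suc j) Ps" using j by (rule id_take_nth_drop)
    have "take j Ps \<in> lists segments" "Ps ! j \<in> segments" "drop (Suc j) Ps \<in> lists segments"
      using Ps by (subst (asm) eq, simp)+
    moreover have "p = mark (take j Ps, Ps ! j, drop (Suc j) Ps)"
      using p eq j by simp
    ultimately show ?thesis by blast
  qed
  then show "mark ` (lists segments \<times> segments \<times> lists segments) = rooted"
    by (auto simp: rooted_def)
qed

lemma finite_fibres_rooted: "finite_fibres (\<lambda>p. total_ups (fst p)) rooted"
  unfolding finite_fibres_def
proof
  fix n
  have "{p \<in> rooted. total_ups (fst p) = n} \<subseteq> {Ps \<in> lists segments. total_ups Ps = n} \<times> {..n}"
    using length_le_total_ups by (fastforce simp: rooted_def)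
  then show "finite {p \<in> rooted. total_ups (fst p) = n}"
    by (rule finite_subset) (use finite_fibres_compositions in \<open>simp add: finite_fibres_def\<close>)
qed

lemma gf_rooted:
  "gf (\<lambda>p. total_ups (fst p)) rooted =
     gf total_ups (lists segments) * (gf ups segments * gf total_ups (lists segments))"
proof -
  have fin: "finite_fibres ups segments"
    using finite_fibres_dyck by (rule finite_fibres_subset) auto
  have "gf (\<lambda>p. total_ups (fst p)) rooted =
      gf (\<lambda>(A, q). total_ups A + (case q of (P, B) \<Rightarrow> ups P + total_ups B))
        (lists segments \<times> segments \<times> lists segments)"
    by (rule gf_bij_betw[OF bij_betw_mark]) auto
  also have "\<dots> = gf total_ups (lists segments) *
      gf (\<lambda>(P, B). ups P + total_ups B) (segments \<times> lists segments)"
    by (rule gf_Times[OF finite_fibres_compositions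
          finite_fibres_Times[OF fin finite_fibres_compositions]])
  also have "gf (\<lambda>(P, B). ups P + total_ups B) (segments \<times> lists segments) =
      gf ups segments * gf total_ups (lists segments)"
    by (rule gf_Times[OF fin finite_fibres_compositions])
  finally show ?thesis .
qed

section \<open>Solving for the generating function and extracting coefficients\<close>

lemma gf_rooted_rational: "gf (\<lambda>p. total_ups (fst p)) rooted * (1 - 4 * fps_X) = fps_X"
proof -
  define C E B W where "C = gf ups dyck" and "E = gf ups segments"
    and "B = gf total_ups (lists segments)" and "W = gf (\<lambda>p. total_ups (fst p)) rooted"
  note defs = C_def E_def B_def W_def
  have C: "C = 1 + E" and E: "E = fps_X * C\<^sup>2" and B: "B = 1 + E * B" and W: "W = B * (E * B)"
    using gf_dyck gf_nonempty_dyck gf_compositions gf_rooted by (simp_all only: defs)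
  have "C \<noteq> 0"
  proof
    assume "C = 0"
    with C E show False by simp
  qed
  \<comment> \<open>Thus \<open>B\<close> is the inverse of \<open>1 - E\<close>, which is the
    \<open>2 - C\<close> of the overview.\<close>
  have inv: "B * (1 - E) = 1" using B by (simp add: algebra_simps)
  have "W * (1 - 4 * fps_X) * C\<^sup>2 = W * (C\<^sup>2 - 4 * E)"
    by (subst E) (simp add: algebra_simps)
  \<comment> \<open>Here \<open>C\<close> is replaced by \<open>1 + E\<close>, which turns the left
    side into a perfect square.\<close>
  also have "C\<^sup>2 - 4 * E = (1 - E)\<^sup>2"
    by (simp add: C power2_eq_square algebra_simps)
  also have "W * (1 - E)\<^sup>2 = E * (B * (1 - E))\<^sup>2"
    by (simp add: W power2_eq_square mult_ac)
  also have "\<dots> = fps_X * C\<^sup>2"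
    by (simp add: inv flip: E)
  finally have "W * (1 - 4 * fps_X) * C\<^sup>2 = fps_X * C\<^sup>2" .
  moreover have "C\<^sup>2 \<noteq> 0" using \<open>C \<noteq> 0\<close> by simp
  ultimately show ?thesis unfolding W_def[symmetric] by (metis mult_right_cancel)
qed

lemma card_rooted_compositions: "card (rooted_compositions (Suc n)) = 4 ^ n"
proof -
  define W where "W = gf (\<lambda>p. total_ups (fst p)) rooted"
  have "W * (1 - 4 * fps_X) = fps_X"
    using gf_rooted_rational by (simp only: W_def)
  then have "W = fps_X + fps_X * (4 * W)"
    by (simp add: algebra_simps)
  then have "W $ m = (fps_X + fps_X * (4 * W)) $ m" for m
    by (rule arg_cong)
  also have "(fps_X + fps_X * (4 * W)) $ m = fps_X $ m + (if m = 0 then 0 else 4 * W $ (m - 1))" for m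
    by (simp add: numeral_fps_const)
  finally have rec: "W $ m = fps_X $ m + (if m = 0 then 0 else 4 * W $ (m - 1))" for m .
  \<comment> \<open>The constant coefficient vanishes, the next one comes from \<open>fps_X\<close>
    alone, and each later one is four times its predecessor.\<close>
  have "W $ Suc n = 4 ^ n"
  proof (induction n)
    case 0
    show ?case using rec[of 1] rec[of 0] by simp
  next
    case (Suc n)
    then show ?case using rec[of "Suc (Suc n)"] by simp
  qed
  then have "int (card (rooted_compositions (Suc n))) = int (4 ^ n)"
    by (simp add: W_def gf_nth rooted_compositions_eq)
  then show ?thesis by (simp only: of_nat_eq_iff)
qed

theorem theorem3p2:
  fixes i :: nat
  assumes "i \<ge> 1"
  shows "\<exists>f. bij_betw f (rooted_compositions i) (four_letter_seqs (i - 1))"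
proof (rule finite_same_card_bij)
  have eq: "four_letter_seqs m = {w. set w \<subseteq> {1, 2, 3, 4} \<and> length w = m}" for m
    by (auto simp: four_letter_seqs_def)
  show "finite (rooted_compositions i)"
    using finite_fibres_rooted by (simp add: rooted_compositions_eq finite_fibres_def)
  show "finite (four_letter_seqs (i - 1))"
    unfolding eq by (rule finite_lists_length_eq) simp
  have "card (four_letter_seqs (i - 1)) = 4 ^ (i - 1)"
    unfolding eq by (subst card_lists_length_eq) (simp_all add: eval_nat_numeral)
  then show "card (rooted_compositions i) = card (four_letter_seqs (i - 1))"
    using assms card_rooted_compositions[of "i - 1"] by simp
qed

end
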